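(* Let $0<\alpha,\beta<1$ and consider the cyclic interacting urn model with two urns and two colors, red (color 1) and black (color 2), described in the context, with replacement matrices $$R_1=\begin{pmatrix} \alpha & 1-\alpha \\ 0 & 1 \end{pmatrix},\qquad R_2=\begin{pmatrix} 1 & 0 \\ 1-\beta & \beta \end{pmatrix},$$ and at least one ball in each urn initially. 1. If $X_t$ and $Y_t$ denote the proportion vectors of colors of the first and the second urn respectively, then almost surely, as $t\to\infty$, $$X_t\to\left(\frac{\alpha-\alpha\beta}{1-\alpha\beta},\ \frac{1-\alpha}{1-\alpha\beta}\right),\qquad Y_t\to\left(\frac{1-\beta}{1-\alpha\beta},\ \frac{\beta-\alpha\beta}{1-\alpha\beta}\right).$$ 2. In the limiting case, either none of the urns flips or exactly one of them flips; both urns cannot flip simultaneously in the limiting case.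
   Context: Model: the composition vector of an urn is the row vector in $\mathbb{R}^2$ of the amounts (possibly non-integer) of red and black in it; the proportion vector of an urn is its composition vector divided by the sum of its entries; $X_t,Y_t$ are the proportion vectors after $t$ steps. At each odd step a ball is drawn at random from urn 1 (conditionally on the past, each color is drawn with probability equal to its current proportion in that urn), and if the drawn color is $j$, the $j$-th row of $R_2$ is added to the composition of urn 2. At each even step a ball is drawn at random in the same way from urn 2, and if the drawn color is $j$, the $j$-th row of $R_1$ is added to the composition of urn 1. Flipping: the dominant color of urn 1 is black (color 2) and the dominant color of urn 2 is red (color 1). An urn flips in the limiting case if, in the almost sure limit of its proportion vector, the proportion of its dominant color is strictly less than the proportion of the other color. *)

theory Defs
  imports "HOL-Probability.Probability"
begin

abbreviation red :: 2 where "red \<equiv> 1"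
abbreviation black :: 2 where "black \<equiv> 2"

definition amount :: "real^2 \<Rightarrow> real" where
  "amount u = (\<Sum>j\<in>UNIV. u $ j)"

definition proportion :: "real^2 \<Rightarrow> real^2" where
  "proportion u = (1 / amount u) *\<^sub>R u"

text \<open>
  \<open>U t\<close> and \<open>V t\<close> are the composition vectors of urns 1 and 2 after \<open>t\<close> steps, and
  \<open>D t\<close> is the color drawn at step \<open>t \<ge> 1\<close> (\<open>D 0\<close> is irrelevant). The step leading from
  time \<open>t\<close> to time \<open>Suc t\<close> is an odd step iff \<open>t\<close> is even. The past up to time \<open>t\<close> is
  \<open>F t\<close>, for an arbitrary filtration \<open>F\<close> to which the draws are adapted; the one generated
  by the draws is a special case.
\<close>

locale cyclic_urns = prob_space M + filtration "space M" F
  for M :: "'a measure" and F :: "nat \<Rightarrow> 'a measure" +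
  fixes R1 R2 :: "real^2^2"
    and u0 v0 :: "real^2"
    and D :: "nat \<Rightarrow> 'a \<Rightarrow> 2"
    and U V :: "nat \<Rightarrow> 'a \<Rightarrow> real^2"
  assumes initial_nonneg: "0 \<le> u0 $ j" "0 \<le> v0 $ j"
    and subalg: "subalgebra M (F t)"
    and draw_adapted: "D (Suc t) \<in> measurable (F (Suc t)) (count_space UNIV)"
    and initial: "w \<in> space M \<Longrightarrow> U 0 w = u0" "w \<in> space M \<Longrightarrow> V 0 w = v0"
    and odd_step: "w \<in> space M \<Longrightarrow> even t \<Longrightarrow>
        U (Suc t) w = U t w \<and> V (Suc t) w = V t w + row (D (Suc t) w) R2"
    and even_step: "w \<in> space M \<Longrightarrow> odd t \<Longrightarrow>
        U (Suc t) w = U t w + row (D (Suc t) w) R1 \<and> V (Suc t) w = V t w"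
    and draw_prob: "AE w in M.
        real_cond_exp M (F t) (indicator {x \<in> space M. D (Suc t) x = j}) w
          = proportion (if even t then U t w else V t w) $ j"

text \<open>
  An urn with proportion process \<open>X\<close> and dominant color \<open>c\<close> flips in the limiting case.
\<close>

definition flips :: "'a measure \<Rightarrow> (nat \<Rightarrow> 'a \<Rightarrow> real^2) \<Rightarrow> 2 \<Rightarrow> bool" where
  "flips M X c \<longleftrightarrow>
    (\<exists>L. (AE w in M. (\<lambda>t. X t w) \<longlonglongrightarrow> L) \<and> (\<forall>j. j \<noteq> c \<longrightarrow> L $ c < L $ j))"

end

theory Submission
  imports Defs "HOL-Library.Discrete_Functions"
begin

text \<open>
  Write \<open>x\<close>, \<open>y\<close> for the proportions of red in the two urns. Replacing each draw by its conditional
  probability costs a martingale with bounded increments, which is \<open>o(t)\<close> almost surely: its second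
  moment grows linearly, so it is controlled along the squares, and the increments bridge the gaps.
  Hence \<open>x\<close> is, up to \<open>o(1)\<close>, the running average of \<open>\<alpha> y\<close> over the odd times and \<open>y\<close> that of
  \<open>1 - \<beta> + \<beta> x\<close> over the even times. Averaging does not increase the upper limit of the distance to
  a constant, so the distances to the fixed point of \<open>x = \<alpha> y\<close>, \<open>y = 1 - \<beta> + \<beta> x\<close> contract by
  \<open>max \<alpha> \<beta> < 1\<close> again and again and vanish in the limit. If both urns flipped, adding
  \<open>1 - \<alpha> < \<alpha> - \<alpha> \<beta>\<close> and \<open>1 - \<beta> < \<beta> - \<alpha> \<beta>\<close> would give \<open>(1 - \<alpha>) (1 - \<beta>) < 0\<close>.
\<close>

section \<open>Strong law for bounded martingale differences\<close>

context prob_space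
begin

context
  fixes F :: "nat \<Rightarrow> 'a measure" and \<xi> :: "nat \<Rightarrow> 'a \<Rightarrow> real" and B :: real
  assumes filt: "filtration (space M) F"
    and subalg: "\<And>n. subalgebra M (F n)"
    and adapted: "\<And>n. \<xi> n \<in> borel_measurable (F (Suc n))"
    and bounded: "\<And>n. AE w in M. \<bar>\<xi> n w\<bar> \<le> B"
    and centered: "\<And>n. AE w in M. real_cond_exp M (F n) (\<xi> n) w = 0"
begin

text \<open>\<open>\<xi> k\<close> is known at time \<open>Suc k\<close>, so the terms with
  \<open>k < n\<close> are all known at time \<open>n\<close>. This lets the partial sum be pulled
  out of a conditional expectation given \<open>F n\<close>.\<close>

lemma sum_adapted: "(\<lambda>w. \<Sum>k<n. \<xi> k w) \<in> borel_measurable (F n)"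
proof (rule borel_measurable_sum)
  fix k assume "k \<in> {..<n}"
  then have "sets (F (Suc k)) \<subseteq> sets (F n)"
    using filtration.sets_F_mono[OF filt, of "Suc k" n] by auto
  then show "\<xi> k \<in> borel_measurable (F n)"
    using adapted[of k] filtration.space_F[OF filt]
    by (intro measurable_from_subalg[of "F n" "F (Suc k)"]) (simp_all add: subalgebra_def)
qed

lemma difference_measurable[measurable]: "\<xi> n \<in> borel_measurable M"
  using adapted measurable_from_subalg subalg by blast

lemma AE_sum_bounded: "AE w in M. \<bar>\<Sum>k<n. \<xi> k w\<bar> \<le> n * B"
proof -
  have "AE w in M. \<forall>k. \<bar>\<xi> k w\<bar> \<le> B"
    using bounded by (simp add: AE_all_countable)
  then show ?thesis
  proof eventually_elim
    case (elim w)
    have "\<bar>\<Sum>k<n. \<xi> k w\<bar> \<le> (\<Sum>k<n. B)"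
      using elim by (intro order_trans[OF sum_abs sum_mono]) auto
    then show ?case by simp
  qed
qed

lemma bound_nonneg: "0 \<le> B"
proof -
  have "AE w in M. 0 \<le> B"
    using bounded[of 0] by eventually_elim linarith
  then show ?thesis by simp
qed

text \<open>Orthogonality of martingale differences: when the square of the next partial sum is
  expanded, the cross term integrates to 0, so each step adds at most \<open>B\<^sup>2\<close>.
  Integrability goes through the same induction because splitting the integral needs it.\<close>

lemma sum_second_moment:
  "integrable M (\<lambda>w. (\<Sum>k<n. \<xi> k w)\<^sup>2) \<and> (\<integral>w. (\<Sum>k<n. \<xi> k w)\<^sup>2 \<partial>M) \<le> n * B\<^sup>2"
proof (induction n)
  case 0
  then show ?case by simp
next
  case (Suc n)
  let ?S = "\<lambda>w. \<Sum>k<n. \<xi> k w"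
  interpret cond: sigma_finite_subalgebra M "F n"
    using finite_measure_subalgebra_is_sigma_finite finite_measure_subalgebra.intro
      finite_measure_subalgebra_axioms.intro subalg finite_measure_axioms by metis
  have int_prod: "integrable M (\<lambda>w. ?S w * \<xi> n w)"
  proof (rule integrable_const_bound[where B = "(n * B) * B"])
    show "AE w in M. norm (?S w * \<xi> n w) \<le> n * B * B"
      using AE_sum_bounded[of n] bounded[of n]
    proof eventually_elim
      case (elim w)
      then show ?case
        by (simp only: real_norm_def abs_mult) (intro mult_mono, auto simp: bound_nonneg)
    qed
  qed measurable
  \<comment> \<open>The factor \<open>?S\<close> is measurable with respect to \<open>F n\<close>,
    so \<open>\<xi> n\<close> may be replaced by its conditional expectation, which
    vanishes.\<close>
  have "(\<integral>w. ?S w * \<xi> n w \<partial>M) = (\<integral>w. ?S w * real_cond_exp M (F n) (\<xi> n) w \<partial>M)"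
    using cond.real_cond_exp_intg(2)[OF int_prod sum_adapted difference_measurable] by simp
  also have "\<dots> = (\<integral>w. 0 \<partial>M)"
    using centered[of n] by (intro integral_cong_AE) (auto intro: measurable_from_subalg[OF subalg])
  finally have prod_0: "(\<integral>w. ?S w * \<xi> n w \<partial>M) = 0" by simp
  have AE_sq: "AE w in M. (\<xi> n w)\<^sup>2 \<le> B\<^sup>2"
    using bounded[of n] by eventually_elim (simp add: abs_le_square_iff[symmetric] bound_nonneg)
  have int_sq: "integrable M (\<lambda>w. (\<xi> n w)\<^sup>2)"
    using AE_sq by (intro integrable_const_bound[where B = "B\<^sup>2"]) auto
  have sq_le: "(\<integral>w. (\<xi> n w)\<^sup>2 \<partial>M) \<le> B\<^sup>2"
    using integral_mono_AE[OF int_sq _ AE_sq] by (simp add: prob_space)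
  have eq: "(\<Sum>k<Suc n. \<xi> k w)\<^sup>2 = (?S w)\<^sup>2 + 2 * (?S w * \<xi> n w) + (\<xi> n w)\<^sup>2" for w
    by (simp add: power2_sum)
  show ?case
    unfolding eq using Suc.IH int_prod int_sq sq_le prod_0 by (simp add: algebra_simps)
qed

text \<open>At the squares the mean has second moment at most \<open>B\<^sup>2 / n\<^sup>2\<close>,
  which is summable. Hence the series of squared means has finite expectation, is finite almost
  surely, and its terms tend to 0.\<close>

lemma AE_square_means_tendsto_0:
  "AE w in M. (\<lambda>n. (\<Sum>k<n\<^sup>2. \<xi> k w) / n\<^sup>2) \<longlonglongrightarrow> 0"
proof -
  \<comment> \<open>The shift to \<open>Suc n\<close> keeps the denominator nonzero and matches the
    series of \<open>1 / (n + 1)\<^sup>2\<close>; it is undone at the end.\<close>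
  define f where "f n w = ((\<Sum>k<(Suc n)\<^sup>2. \<xi> k w) / (Suc n)\<^sup>2)\<^sup>2" for n w
  have f_meas[measurable]: "f n \<in> borel_measurable M" for n
    unfolding f_def by measurable
  have nn_f: "(\<integral>\<^sup>+w. ennreal (f n w) \<partial>M) \<le> ennreal (B\<^sup>2 * (1 / (real n + 1)\<^sup>2))" for n
  proof -
    let ?N = "(Suc n)\<^sup>2"
    have int: "integrable M (f n)"
      unfolding f_def power_divide using sum_second_moment by simp
    have aux: "m * B\<^sup>2 / m\<^sup>2 = B\<^sup>2 * (1 / m)" for m
      by (simp add: power2_eq_square)
    have "(\<integral>w. f n w \<partial>M) = (\<integral>w. (\<Sum>k<?N. \<xi> k w)\<^sup>2 \<partial>M) / (real ?N)\<^sup>2"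
      unfolding f_def power_divide by simp
    also have "\<dots> \<le> (?N * B\<^sup>2) / (real ?N)\<^sup>2"
      using sum_second_moment[of ?N] by (intro divide_right_mono) auto
    also have "\<dots> = B\<^sup>2 * (1 / real ?N)"
      using aux .
    also have "\<dots> = B\<^sup>2 * (1 / (real n + 1)\<^sup>2)" by (simp add: add.commute)
    finally have "ennreal (\<integral>w. f n w \<partial>M) \<le> ennreal (B\<^sup>2 * (1 / (real n + 1)\<^sup>2))"
      by (rule ennreal_leI)
    moreover have "AE w in M. 0 \<le> f n w" by (simp add: f_def)
    ultimately show ?thesis
      by (simp only: nn_integral_eq_integral[OF int])
  qed
  have "(\<integral>\<^sup>+w. (\<Sum>n. ennreal (f n w)) \<partial>M) = (\<Sum>n. \<integral>\<^sup>+w. ennreal (f n w) \<partial>M)"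
    by (intro nn_integral_suminf) measurable
  also have "\<dots> \<le> (\<Sum>n. ennreal (B\<^sup>2 * (1 / (real n + 1)\<^sup>2)))"
    by (intro suminf_le nn_f) auto
  also have "\<dots> = ennreal (\<Sum>n. B\<^sup>2 * (1 / (real n + 1)\<^sup>2))"
    using summable_mult[OF sums_summable[OF inverse_squares_sums], of "B\<^sup>2"]
    by (subst suminf_ennreal2) (auto simp: add_ac)
  also have "\<dots> < \<infinity>" by simp
  finally have "AE w in M. (\<Sum>n. ennreal (f n w)) \<noteq> \<infinity>"
    by (intro nn_integral_PInf_AE) (auto simp: less_top)
  then show ?thesis
  proof eventually_elim
    case (elim w)
    then have "summable (\<lambda>n. f n w)"
      by (intro summable_suminf_not_top) (auto simp: f_def)
    then have "(\<lambda>n. f n w) \<longlonglongrightarrow> 0"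
      by (rule summable_LIMSEQ_zero)
    then have "(\<lambda>n. sqrt (f n w)) \<longlonglongrightarrow> sqrt 0"
      by (rule tendsto_real_sqrt)
    then have "(\<lambda>n. (\<Sum>k<(Suc n)\<^sup>2. \<xi> k w) / (Suc n)\<^sup>2) \<longlonglongrightarrow> 0"
      by (subst tendsto_rabs_zero_iff[symmetric]) (simp add: f_def)
    then show ?case
      by (rule LIMSEQ_imp_Suc[where f = "\<lambda>n. (\<Sum>k<n\<^sup>2. \<xi> k w) / n\<^sup>2"])
  qed
qed

text \<open>With \<open>k = floor_sqrt n\<close>, at most \<open>2 * k\<close> increments separate
  the partial sum at \<open>n\<close> from the one at \<open>k\<^sup>2\<close>. Each is at most
  \<open>B\<close> in absolute value, so after division by \<open>n \<ge> k\<^sup>2\<close> they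
  cost at most \<open>2 * B / k\<close>.\<close>

theorem martingale_difference_slln: "AE w in M. (\<lambda>n. (\<Sum>k<n. \<xi> k w) / n) \<longlonglongrightarrow> 0"
proof -
  have "AE w in M. \<forall>k. \<bar>\<xi> k w\<bar> \<le> B"
    using bounded by (simp add: AE_all_countable)
  then show ?thesis
    using AE_square_means_tendsto_0
  proof eventually_elim
    case (elim w)
    define S where "S n = (\<Sum>k<n. \<xi> k w)" for n
    have lim: "filterlim floor_sqrt at_top sequentially"
      unfolding filterlim_at_top by (auto simp: le_floor_sqrt_iff intro: eventually_ge_at_top)
    have "(\<lambda>n. \<bar>S (n\<^sup>2) / n\<^sup>2\<bar> + 2 * B / n) \<longlonglongrightarrow> 0 + 0"
      using elim(2) unfolding S_def
      by (intro tendsto_add tendsto_rabs_zero lim_const_over_n)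
    then have "(\<lambda>n. \<bar>S ((floor_sqrt n)\<^sup>2) / (floor_sqrt n)\<^sup>2\<bar> + 2 * B / floor_sqrt n)
        \<longlonglongrightarrow> 0"
      using lim by (auto dest: filterlim_compose)
    moreover have "\<forall>\<^sub>F n in sequentially. norm (S n / n)
        \<le> \<bar>S ((floor_sqrt n)\<^sup>2) / (floor_sqrt n)\<^sup>2\<bar> + 2 * B / floor_sqrt n"
      using eventually_gt_at_top[of 0]
    proof eventually_elim
      case (elim n)
      define k where "k = floor_sqrt n"
      \<comment> \<open>The last bound is \<open>n < (k + 1)\<^sup>2\<close> over the
        integers.\<close>
      have k: "0 < n" "0 < k" "k\<^sup>2 \<le> n" "n \<le> k\<^sup>2 + 2 * k"
        using elim Suc_floor_sqrt_power2_gt[of n] unfolding k_def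
        by (simp, simp, simp, simp add: power2_eq_square)
      have "S n = S (k\<^sup>2) + (\<Sum>i=k\<^sup>2..<n. \<xi> i w)"
        using sum.atLeastLessThan_concat[of 0 "k\<^sup>2" n "\<lambda>i. \<xi> i w"] k
        by (simp add: S_def atLeast0LessThan)
      moreover have "\<bar>\<Sum>i=k\<^sup>2..<n. \<xi> i w\<bar> \<le> (\<Sum>i=k\<^sup>2..<n. B)"
        using \<open>\<forall>k. \<bar>\<xi> k w\<bar> \<le> B\<close> by (intro order_trans[OF sum_abs sum_mono]) auto
      moreover have "(\<Sum>i=k\<^sup>2..<n. B) \<le> 2 * k * B"
      proof -
        have "real (n - k\<^sup>2) \<le> real (2 * k)" using k by (intro of_nat_mono) linarith
        then show ?thesis using bound_nonneg k(3)
          by (simp add: mult_right_mono del: of_nat_diff)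
      qed
      ultimately have "\<bar>S n\<bar> \<le> \<bar>S (k\<^sup>2)\<bar> + 2 * k * B" by linarith
      then have "\<bar>S n\<bar> / n \<le> (\<bar>S (k\<^sup>2)\<bar> + 2 * k * B) / n"
        by (intro divide_right_mono) auto
      also have "\<dots> \<le> (\<bar>S (k\<^sup>2)\<bar> + 2 * k * B) / k\<^sup>2"
        using k bound_nonneg by (intro divide_left_mono mult_pos_pos) (auto simp flip: of_nat_power)
      also have "\<dots> = \<bar>S (k\<^sup>2) / k\<^sup>2\<bar> + 2 * B / k"
        using k by (simp add: add_divide_distrib power2_eq_square)
      finally show ?case by (simp add: k_def)
    qed
    ultimately show ?case
      unfolding S_def by (rule Lim_null_comparison[rotated])
  qed
qed

end

text \<open>The deviation of an indicator from its conditional probability is a martingale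
  difference bounded by 1. The coefficients \<open>c\<close> will be parity indicators, which select
  the steps that reinforce one given urn.\<close>

corollary conditional_frequency_slln:
  assumes filt: "filtration (space M) F"
    and subalg: "\<And>n. subalgebra M (F n)"
    and A: "\<And>n. A n \<in> sets (F (Suc n))"
    and c: "\<And>n. \<bar>c n\<bar> \<le> (1::real)"
  shows "AE w in M. (\<lambda>n. (\<Sum>k<n. c k *
      (indicator (A k) w - real_cond_exp M (F k) (indicator (A k)) w)) / n) \<longlonglongrightarrow> 0"
proof (rule martingale_difference_slln[where B = 1, OF filt subalg])
  fix n
  interpret cond: sigma_finite_subalgebra M "F n"
    using finite_measure_subalgebra_is_sigma_finite finite_measure_subalgebra.intro
      finite_measure_subalgebra_axioms.intro subalg finite_measure_axioms by metis
  let ?I = "indicator (A n) :: 'a \<Rightarrow> real"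
  let ?E = "real_cond_exp M (F n) ?I"
  have A_M[measurable]: "A n \<in> sets M"
    using A subalg by (auto simp: subalgebra_def)
  have int: "integrable M ?I"
    by (simp add: emeasure_eq_measure)
  note int_E = cond.real_cond_exp_int(1)[OF int]
  have [measurable]: "?E \<in> borel_measurable (F (Suc n))"
    using filtration.sets_F_mono[OF filt, of n "Suc n"] filtration.space_F[OF filt]
    by (intro measurable_from_subalg[OF _ borel_measurable_cond_exp]) (auto simp: subalgebra_def)
  have [measurable]: "A n \<in> sets (F (Suc n))" by (rule A)
  show "(\<lambda>w. c n * (?I w - ?E w)) \<in> borel_measurable (F (Suc n))" by measurable
  have "AE w in M. 0 \<le> ?E w" "AE w in M. ?E w \<le> 1"
    by (intro cond.real_cond_exp_ge_c cond.real_cond_exp_le_c int; simp)+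
  then show "AE w in M. \<bar>c n * (?I w - ?E w)\<bar> \<le> 1"
  proof eventually_elim
    case (elim w)
    then have "\<bar>?I w - ?E w\<bar> \<le> 1" by (auto simp: indicator_def)
    then show ?case
      using mult_mono[OF c[of n], of "\<bar>?I w - ?E w\<bar>" 1] by (simp add: abs_mult)
  qed
  have "AE w in M. real_cond_exp M (F n) (\<lambda>w. c n * (?I w - ?E w)) w
      = c n * real_cond_exp M (F n) (\<lambda>w. ?I w - ?E w) w"
    using int int_E by (intro cond.real_cond_exp_cmult) auto
  moreover have "AE w in M. real_cond_exp M (F n) (\<lambda>w. ?I w - ?E w) w
      = ?E w - real_cond_exp M (F n) ?E w"
    using int int_E by (rule cond.real_cond_exp_diff)
  moreover have "AE w in M. real_cond_exp M (F n) ?E w = ?E w"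
    using int_E by (rule cond.real_cond_exp_F_meas) simp
  ultimately show "AE w in M. real_cond_exp M (F n) (\<lambda>w. c n * (?I w - ?E w)) w = 0"
    by eventually_elim simp
qed

end

section \<open>Coupled running averages\<close>

text \<open>Cesaro argument: the terms before \<open>T\<close> contribute a fixed amount, negligible
  against the diverging total weight, and the later terms are bounded by \<open>c\<close> and carry
  at most the total weight.\<close>

lemma eventually_weighted_mean_le:
  fixes z w :: "nat \<Rightarrow> real" and a c \<epsilon> :: real
  assumes w: "\<And>s. 0 \<le> w s" and a: "0 < a"
    and W: "filterlim (\<lambda>t. a + (\<Sum>s<t. w s)) at_top sequentially"
    and z: "\<forall>\<^sub>F t in sequentially. \<bar>z t\<bar> \<le> c"
    and "0 < \<epsilon>"
  shows "\<forall>\<^sub>F t in sequentially. \<bar>\<Sum>s<t. w s * z s\<bar> / (a + (\<Sum>s<t. w s)) \<le> c + \<epsilon>"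
proof -
  obtain T where T: "\<And>t. t \<ge> T \<Longrightarrow> \<bar>z t\<bar> \<le> c"
    using z by (auto simp: eventually_at_top_linorder)
  have c: "0 \<le> c" using T[of T] by linarith
  define K where "K = \<bar>\<Sum>s<T. w s * z s\<bar>"
  have "((\<lambda>t. K / (a + (\<Sum>s<t. w s))) \<longlongrightarrow> 0) sequentially"
    by (intro tendsto_divide_0[OF tendsto_const] filterlim_at_top_imp_at_infinity W)
  then have "\<forall>\<^sub>F t in sequentially. K / (a + (\<Sum>s<t. w s)) < \<epsilon>"
    using \<open>0 < \<epsilon>\<close> by (rule order_tendstoD)
  then show ?thesis
    using eventually_ge_at_top[of T]
  proof eventually_elim
    case (elim t)
    let ?W = "a + (\<Sum>s<t. w s)"
    have W_pos: "0 < ?W" using a w by (simp add: add_pos_nonneg sum_nonneg)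
    have "(\<Sum>s<t. w s * z s) = (\<Sum>s<T. w s * z s) + (\<Sum>s=T..<t. w s * z s)"
      using sum.atLeastLessThan_concat[of 0 T t "\<lambda>s. w s * z s"] elim
      by (simp add: atLeast0LessThan)
    moreover have "\<bar>\<Sum>s=T..<t. w s * z s\<bar> \<le> (\<Sum>s=T..<t. w s * c)"
      using T w by (intro order_trans[OF sum_abs sum_mono]) (auto simp: abs_mult intro!: mult_left_mono)
    moreover have "(\<Sum>s=T..<t. w s * c) \<le> ?W * c"
    proof -
      have "(\<Sum>s=T..<t. w s) \<le> (\<Sum>s<t. w s)"
        using w by (intro sum_mono2) auto
      then show ?thesis
        using a c by (auto simp flip: sum_distrib_right intro!: mult_right_mono)
    qed
    ultimately have "\<bar>\<Sum>s<t. w s * z s\<bar> \<le> K + ?W * c"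
      unfolding K_def by linarith
    then have "\<bar>\<Sum>s<t. w s * z s\<bar> / ?W \<le> (K + ?W * c) / ?W"
      using W_pos by (intro divide_right_mono) auto
    also have "\<dots> = K / ?W + c" using W_pos by (simp add: add_divide_distrib)
    finally show ?case using elim by linarith
  qed
qed

text \<open>An asymptotic bound on one sequence passes through the averaging to the other with a
  factor of at most \<open>max p q < 1\<close>. Starting from the bound 1, iteration yields every
  power of this factor.\<close>

lemma coupled_means_tendsto_0:
  fixes x y v w e f :: "nat \<Rightarrow> real" and a b p q :: real
  assumes pq: "0 \<le> p" "p < 1" "0 \<le> q" "q < 1" and ab: "0 < a" "0 < b"
    and w: "\<And>s. 0 \<le> w s" "filterlim (\<lambda>t. a + (\<Sum>s<t. w s)) at_top sequentially"
    and v: "\<And>s. 0 \<le> v s" "filterlim (\<lambda>t. b + (\<Sum>s<t. v s)) at_top sequentially"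
    and x: "\<And>t. x t = p * (\<Sum>s<t. w s * y s) / (a + (\<Sum>s<t. w s)) + e t" "e \<longlonglongrightarrow> 0"
    and y: "\<And>t. y t = q * (\<Sum>s<t. v s * x s) / (b + (\<Sum>s<t. v s)) + f t" "f \<longlonglongrightarrow> 0"
    and bnd: "\<And>t. \<bar>x t\<bar> \<le> 1" "\<And>t. \<bar>y t\<bar> \<le> 1"
  shows "x \<longlonglongrightarrow> 0" "y \<longlonglongrightarrow> 0"
proof -
  define r where "r = max p q"
  have r: "0 \<le> r" "r < 1" "p \<le> r" "q \<le> r" using pq by (auto simp: r_def)
  \<comment> \<open>Stated for arbitrary sequences because it serves both directions,
    \<open>x\<close> from \<open>y\<close> and \<open>y\<close> from \<open>x\<close>. Of the slack,
    \<epsilon> / 2 goes to the error term and \<epsilon> / 4 each to the bound on \<open>y\<close>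
    and to the averaging.\<close>
  have step: "\<forall>\<^sub>F t in sequentially. \<bar>x t\<bar> \<le> r * c + \<epsilon>"
    if w: "\<And>s. 0 \<le> w s" "filterlim (\<lambda>t. a + (\<Sum>s<t. w s)) at_top sequentially"
      and x: "\<And>t. x t = p * (\<Sum>s<t. w s * y s) / (a + (\<Sum>s<t. w s)) + e t" "e \<longlonglongrightarrow> 0"
      and p: "0 \<le> p" "p \<le> r" and a: "0 < a" and "0 < \<epsilon>"
      and y: "\<And>\<epsilon>. 0 < \<epsilon> \<Longrightarrow> \<forall>\<^sub>F t in sequentially. \<bar>y t\<bar> \<le> c + \<epsilon>"
    for x y w e :: "nat \<Rightarrow> real" and a p c \<epsilon> :: real
  proof -
    have "\<forall>\<^sub>F t in sequentially. \<bar>e t\<bar> < \<epsilon> / 2"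
      using tendsto_rabs_zero[OF x(2)] \<open>0 < \<epsilon>\<close> by (intro order_tendstoD) auto
    moreover have "\<forall>\<^sub>F t in sequentially.
        \<bar>\<Sum>s<t. w s * y s\<bar> / (a + (\<Sum>s<t. w s)) \<le> (c + \<epsilon> / 4) + \<epsilon> / 4"
      using \<open>0 < \<epsilon>\<close> by (intro eventually_weighted_mean_le[OF w(1) a w(2)] y) auto
    ultimately show ?thesis
    proof eventually_elim
      case (elim t)
      let ?m = "\<bar>\<Sum>s<t. w s * y s\<bar> / (a + (\<Sum>s<t. w s))"
      have W_pos: "0 < a + (\<Sum>s<t. w s)" using a w by (simp add: add_pos_nonneg sum_nonneg)
      have "\<bar>x t\<bar> \<le> p * ?m + \<bar>e t\<bar>"
        using W_pos p abs_triangle_ineq[of "p * (\<Sum>s<t. w s * y s) / (a + (\<Sum>s<t. w s))" "e t"]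
        by (simp add: x(1) abs_mult)
      also have "p * ?m \<le> r * (c + \<epsilon> / 2)"
        using elim p r W_pos by (intro mult_mono) auto
      also have "r * (c + \<epsilon> / 2) \<le> r * c + \<epsilon> / 2"
        using r \<open>0 < \<epsilon>\<close> mult_right_mono[of r 1 "\<epsilon> / 2"] by (simp add: algebra_simps)
      finally show ?case using elim by linarith
    qed
  qed
  \<comment> \<open>The two bounds are proved jointly, since each one at \<open>Suc k\<close> rests
    on the other at \<open>k\<close>.\<close>
  have both: "\<forall>\<epsilon>>0. (\<forall>\<^sub>F t in sequentially. \<bar>x t\<bar> \<le> r ^ k + \<epsilon>) \<and>
      (\<forall>\<^sub>F t in sequentially. \<bar>y t\<bar> \<le> r ^ k + \<epsilon>)" for k
  proof (induction k)
    case 0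
    have "\<bar>x t\<bar> \<le> 1 + \<epsilon>" "\<bar>y t\<bar> \<le> 1 + \<epsilon>" if "0 < \<epsilon>" for t \<epsilon>
      using bnd[of t] that by linarith+
    then show ?case by simp
  next
    case (Suc k)
    show ?case
      unfolding power_Suc using Suc.IH
      by (intro allI impI conjI step[OF w x pq(1) r(3) ab(1)] step[OF v y pq(3) r(4) ab(2)]) auto
  qed
  have "z \<longlonglongrightarrow> 0" if z: "\<And>k \<epsilon>. 0 < \<epsilon> \<Longrightarrow> \<forall>\<^sub>F t in sequentially. \<bar>z t\<bar> \<le> r ^ k + \<epsilon>"
    for z :: "nat \<Rightarrow> real"
  proof (rule tendsto_rabs_zero_cancel, rule order_tendstoI)
    fix d :: real assume "0 < d"
    then obtain k where "r ^ k < d / 2"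
      using real_arch_pow_inv[of "d / 2" r] r by auto
    then show "\<forall>\<^sub>F t in sequentially. \<bar>z t\<bar> < d"
      using z[of "d / 2" k] \<open>0 < d\<close> by (auto elim: eventually_mono)
  qed (auto intro: always_eventually less_le_trans)
  then show "x \<longlonglongrightarrow> 0" "y \<longlonglongrightarrow> 0" using both by blast+
qed

lemma tendsto_vec2:
  fixes f :: "nat \<Rightarrow> real ^ 2"
  assumes "(\<lambda>t. f t $ 1) \<longlonglongrightarrow> a" "(\<lambda>t. f t $ 2) \<longlonglongrightarrow> b"
  shows "f \<longlonglongrightarrow> vector [a, b]"
  using assms by (intro vec_tendstoI) (metis (full_types) exhaust_2 vector_2)

lemma amount_eq: "amount u = u $ red + u $ black"
  by (simp add: amount_def sum_2)

section \<open>Growth of the urns and decay of the noise\<close>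

lemma sum_odd: "(\<Sum>s<t. of_bool (odd s)) = real (t div 2)"
  by (induction t) (auto elim: oddE evenE)

lemma sum_even: "(\<Sum>s<t. of_bool (even s)) = real (Suc t div 2)"
  by (induction t) (auto elim: oddE evenE)

text \<open>One linear lower bound for both parities, so that the limit lemmas below serve both
  urns.\<close>

lemma half_weights_ge:
  "real t / 2 - 1 / 2 \<le> (\<Sum>s<t. of_bool (odd s))"
  "real t / 2 - 1 / 2 \<le> (\<Sum>s<t. of_bool (even s))"
  unfolding sum_odd sum_even by linarith+

lemma filterlim_half_weights:
  fixes w :: "nat \<Rightarrow> real"
  assumes "\<And>t. real t / 2 - 1 / 2 \<le> (\<Sum>s<t. w s)"
  shows "filterlim (\<lambda>t. a + (\<Sum>s<t. w s)) at_top sequentially"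
proof (rule filterlim_at_top_mono)
  show "filterlim (\<lambda>t. (a - 1 / 2) + real t * (1 / 2)) at_top sequentially"
    by (intro filterlim_tendsto_add_at_top[OF tendsto_const]
        filterlim_at_top_mult_tendsto_pos[OF tendsto_const] filterlim_real_sequentially) auto
  show "\<forall>\<^sub>F t in sequentially. (a - 1 / 2) + real t * (1 / 2) \<le> a + (\<Sum>s<t. w s)"
  proof (rule always_eventually, rule allI)
    show "(a - 1 / 2) + real t * (1 / 2) \<le> a + (\<Sum>s<t. w s)" for t
      using assms[of t] by linarith
  qed
qed

text \<open>The denominator grows linearly, so it dominates both the constant \<open>C\<close>,
  which will hold the initial composition, and the noise \<open>N\<close>, which is o(t).\<close>

lemma noise_tendsto_0:
  fixes w N :: "nat \<Rightarrow> real"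
  assumes W: "\<And>t. real t / 2 - 1 / 2 \<le> (\<Sum>s<t. w s)" and a: "0 < a"
    and N: "(\<lambda>t. N t / t) \<longlonglongrightarrow> 0"
  shows "(\<lambda>t. (C + p * N t) / (a + (\<Sum>s<t. w s))) \<longlonglongrightarrow> 0"
proof (rule Lim_null_comparison)
  have "(\<lambda>t. C / (a + (\<Sum>s<t. w s))) \<longlonglongrightarrow> 0"
    by (intro tendsto_divide_0[OF tendsto_const] filterlim_at_top_imp_at_infinity
        filterlim_half_weights W)
  from tendsto_add[OF tendsto_rabs_zero[OF this] tendsto_mult_right_zero[OF tendsto_rabs_zero[OF N], of "4 * \<bar>p\<bar>"]]
  show "(\<lambda>t. \<bar>C / (a + (\<Sum>s<t. w s))\<bar> + 4 * \<bar>p\<bar> * \<bar>N t / t\<bar>) \<longlonglongrightarrow> 0"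
    by simp
  show "\<forall>\<^sub>F t in sequentially. norm ((C + p * N t) / (a + (\<Sum>s<t. w s)))
      \<le> \<bar>C / (a + (\<Sum>s<t. w s))\<bar> + 4 * \<bar>p\<bar> * \<bar>N t / t\<bar>"
    using eventually_ge_at_top[of 2]
  proof eventually_elim
    case (elim t)
    let ?W = "a + (\<Sum>s<t. w s)"
    \<comment> \<open>For \<open>t \<ge> 2\<close>, \<open>t / 2 - 1 / 2 \<ge> t / 4\<close>; this
      is the source of the factor 4 in the comparison bound.\<close>
    have "real t / 4 \<le> ?W" using W[of t] elim a by linarith
    then have "\<bar>p * N t\<bar> / \<bar>?W\<bar> \<le> \<bar>p * N t\<bar> / (real t / 4)"
      using elim by (intro divide_left_mono) auto
    then show ?case
      using abs_triangle_ineq[of "C / ?W" "p * N t / ?W"]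
      by (simp add: add_divide_distrib abs_mult mult_ac)
  qed
qed

section \<open>The urns\<close>

locale flipping_urns = cyclic_urns M F R1 R2 u0 v0 D U V
  for M :: "'a measure" and F R1 R2 u0 v0 D U V +
  fixes \<alpha> \<beta> :: real
  assumes \<alpha>: "0 < \<alpha>" "\<alpha> < 1" and \<beta>: "0 < \<beta>" "\<beta> < 1"
    and R1: "R1 = vector [vector [\<alpha>, 1 - \<alpha>], vector [0, 1]]"
    and R2: "R2 = vector [vector [1, 0], vector [1 - \<beta>, \<beta>]]"
    and nonempty: "0 < amount u0" "0 < amount v0"
begin

text \<open>The index is the time before the draw: the event is conditioned on \<open>F t\<close>
  and decided at \<open>F (Suc t)\<close>, as in the strong law above.\<close>

definition red_draw :: "nat \<Rightarrow> 'a set" where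
  "red_draw t = {w \<in> space M. D (Suc t) w = red}"

lemma red_draw_sets: "red_draw t \<in> sets (F (Suc t))"
proof -
  have "red_draw t = D (Suc t) -` {red} \<inter> space (F (Suc t))"
    by (auto simp: red_draw_def space_F)
  then show ?thesis
    using measurable_sets[OF draw_adapted, of "{red}" t] by simp
qed

text \<open>Writing the drawn row as an affine function of the red indicator turns compositions into
  sums of indicators.\<close>

lemma row_R1: "row d R1 $ red = \<alpha> * of_bool (d = red)" "row d R1 $ black = 1 - \<alpha> * of_bool (d = red)"
  using exhaust_2[of d] by (auto simp: row_def R1)

lemma row_R2: "row d R2 $ red = 1 - \<beta> + \<beta> * of_bool (d = red)"
    "row d R2 $ black = \<beta> - \<beta> * of_bool (d = red)"
  using exhaust_2[of d] by (auto simp: row_def R2)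

context
  fixes w assumes w: "w \<in> space M"
begin

lemma indicator_red_draw: "indicator (red_draw t) w = (of_bool (D (Suc t) w = red) :: real)"
  using w by (simp add: red_draw_def indicator_def)

lemma U_red: "U t w $ red = u0 $ red + \<alpha> * (\<Sum>s<t. of_bool (odd s) * indicator (red_draw s) w)"
  by (induction t) (use initial odd_step even_step w in
    \<open>auto simp: indicator_red_draw row_R1 algebra_simps\<close>)

text \<open>The amount is deterministic because each row of \<open>R1\<close> sums to 1; the step
  leaving time \<open>s\<close> reinforces urn 1 exactly when \<open>s\<close> is odd.\<close>

lemma amount_U: "amount (U t w) = amount u0 + (\<Sum>s<t. of_bool (odd s))"
  by (induction t) (use initial odd_step even_step w in \<open>auto simp: amount_eq row_R1\<close>)

lemma V_red: "V t w $ red = v0 $ red + (1 - \<beta>) * (\<Sum>s<t. of_bool (even s))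
    + \<beta> * (\<Sum>s<t. of_bool (even s) * indicator (red_draw s) w)"
  by (induction t) (use initial odd_step even_step w in
    \<open>auto simp: indicator_red_draw row_R2 algebra_simps\<close>)

lemma amount_V: "amount (V t w) = amount v0 + (\<Sum>s<t. of_bool (even s))"
  by (induction t) (use initial odd_step even_step w in \<open>auto simp: amount_eq row_R2\<close>)

lemma amount_pos: "0 < amount (U t w)" "0 < amount (V t w)"
  using nonempty by (auto simp: amount_U amount_V intro!: add_pos_nonneg sum_nonneg)

lemma compositions_nonneg: "0 \<le> U t w $ j" "0 \<le> V t w $ j"
proof -
  have R: "0 \<le> row d R1 $ j" "0 \<le> row d R2 $ j" for d
    using exhaust_2[of j] \<alpha> \<beta> by (auto simp: row_R1 row_R2)
  have "0 \<le> U t w $ j \<and> 0 \<le> V t w $ j"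
  proof (induction t)
    case 0
    then show ?case using initial w initial_nonneg by auto
  next
    case (Suc t)
    then show ?case
      using odd_step[OF w, of t] even_step[OF w, of t] R by (cases "even t") auto
  qed
  then show "0 \<le> U t w $ j" "0 \<le> V t w $ j" by auto
qed

end

section \<open>Almost sure limits of the proportions\<close>

lemma proportion_red_bounds:
  "(\<And>j. 0 \<le> u $ j) \<Longrightarrow> 0 < amount u \<Longrightarrow> 0 \<le> proportion u $ red \<and> proportion u $ red \<le> 1"
  by (auto simp: proportion_def amount_eq)

lemma proportion_black: "0 < amount u \<Longrightarrow> proportion u $ black = 1 - proportion u $ red"
  by (simp add: proportion_def amount_eq field_simps)

text \<open>The red proportions, centered at the claimed limits, are coupled running averages with
  factors \<alpha> and \<beta>; the error terms consist of the initial composition and the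
  martingale noise.\<close>

lemma AE_red_proportions:
  "AE w in M. (\<lambda>t. proportion (U t w) $ red) \<longlonglongrightarrow> (\<alpha> - \<alpha> * \<beta>) / (1 - \<alpha> * \<beta>) \<and>
    (\<lambda>t. proportion (V t w) $ red) \<longlonglongrightarrow> (1 - \<beta>) / (1 - \<alpha> * \<beta>)"
proof -
  define E :: "nat \<Rightarrow> 'a \<Rightarrow> real" where "E s = real_cond_exp M (F s) (indicator (red_draw s))" for s
  define Lx where "Lx = (\<alpha> - \<alpha> * \<beta>) / (1 - \<alpha> * \<beta>)"
  define Ly where "Ly = (1 - \<beta>) / (1 - \<alpha> * \<beta>)"
  have pos: "0 < 1 - \<alpha> * \<beta>"
    using \<alpha> \<beta> mult_strict_mono[of \<alpha> 1 \<beta> 1] by simp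
  \<comment> \<open>Centering at this fixed point removes the constant \<open>1 - \<beta>\<close>
    from the coupled equations.\<close>
  have fixpoint: "Lx = \<alpha> * Ly" "Ly = 1 - \<beta> + \<beta> * Lx"
    using pos by (simp_all add: Lx_def Ly_def field_simps)
  \<comment> \<open>Limits in [0, 1] keep the centered proportions within distance 1 of 0, the
    starting bound of the contraction.\<close>
  have "\<alpha> * \<beta> \<le> \<alpha>" "\<alpha> * \<beta> \<le> \<beta>" using \<alpha> \<beta> by (auto simp: mult_left_le mult_left_le_one_le)
  then have L_bounds: "0 \<le> Lx" "Lx \<le> 1" "0 \<le> Ly" "Ly \<le> 1"
    using pos \<alpha> \<beta> by (auto simp: Lx_def Ly_def divide_simps)
  have filt: "filtration (space M) F" by unfold_locales
  have "AE w in M. \<forall>s. E s w = proportion (if even s then U s w else V s w) $ red"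
    using draw_prob[of _ red] by (simp add: AE_all_countable E_def red_draw_def)
  moreover have "AE w in M.
      (\<lambda>t. (\<Sum>s<t. of_bool (odd s) * (indicator (red_draw s) w - E s w)) / t) \<longlonglongrightarrow> 0"
    unfolding E_def by (rule conditional_frequency_slln[OF filt subalg red_draw_sets]) simp
  moreover have "AE w in M.
      (\<lambda>t. (\<Sum>s<t. of_bool (even s) * (indicator (red_draw s) w - E s w)) / t) \<longlonglongrightarrow> 0"
    unfolding E_def by (rule conditional_frequency_slln[OF filt subalg red_draw_sets]) simp
  ultimately show ?thesis
    using AE_space
  proof eventually_elim
    case (elim w)
    note w = elim(4)
    let ?I = "\<lambda>s. indicator (red_draw s) w :: real"
    let ?o = "\<lambda>s::nat. of_bool (odd s) :: real" and ?e = "\<lambda>s::nat. of_bool (even s) :: real"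
    define x where "x t = proportion (U t w) $ red" for t
    define y where "y t = proportion (V t w) $ red" for t
    define N where "N t = (\<Sum>s<t. ?o s * (?I s - y s))" for t
    define K where "K t = (\<Sum>s<t. ?e s * (?I s - x s))" for t
    \<comment> \<open>Only at odd \<open>s\<close> is the draw made from urn 2, with probability
      \<open>y s\<close>; the weight removes the even times, where the probability is
      \<open>x s\<close>.\<close>
    have N_eq: "N t = (\<Sum>s<t. ?o s * (?I s - E s w))" for t
      unfolding N_def y_def using elim(1) by (intro sum.cong) auto
    have K_eq: "K t = (\<Sum>s<t. ?e s * (?I s - E s w))" for t
      unfolding K_def x_def using elim(1) by (intro sum.cong) auto
    have bnd: "\<bar>x t - Lx\<bar> \<le> 1" "\<bar>y t - Ly\<bar> \<le> 1" for t
      using proportion_red_bounds[OF compositions_nonneg(1) amount_pos(1), OF w w, of t] L_bounds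
        proportion_red_bounds[OF compositions_nonneg(2) amount_pos(2), OF w w, of t]
      unfolding x_def y_def by linarith+
    let ?ex = "\<lambda>t. ((u0 $ red - amount u0 * Lx) + \<alpha> * N t) / (amount u0 + (\<Sum>s<t. ?o s))"
    let ?ey = "\<lambda>t. ((v0 $ red - amount v0 * Ly) + \<beta> * K t) / (amount v0 + (\<Sum>s<t. ?e s))"
    have x_eq: "x t - Lx = \<alpha> * (\<Sum>s<t. ?o s * (y s - Ly)) / (amount u0 + (\<Sum>s<t. ?o s)) + ?ex t" for t
    proof -
      have W: "amount u0 + (\<Sum>s<t. ?o s) \<noteq> 0"
        using amount_pos(1)[OF w, of t] amount_U[OF w, of t] by linarith
      have "x t = U t w $ red / (amount u0 + (\<Sum>s<t. ?o s))"
        by (simp add: x_def proportion_def amount_U[OF w])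
      then have "x t - Lx = (U t w $ red - Lx * (amount u0 + (\<Sum>s<t. ?o s))) / (amount u0 + (\<Sum>s<t. ?o s))"
        using W by (simp add: diff_divide_distrib)
      \<comment> \<open>Since \<open>Lx = \<alpha> * Ly\<close>, an odd time contributes
        \<open>\<alpha> * (?I s - Ly)\<close>, which splits into the drift
        \<open>\<alpha> * (y s - Ly)\<close> and the noise
        \<open>\<alpha> * (?I s - y s)\<close>.\<close>
      also have "U t w $ red - Lx * (amount u0 + (\<Sum>s<t. ?o s))
          = \<alpha> * (\<Sum>s<t. ?o s * (y s - Ly)) + ((u0 $ red - amount u0 * Lx) + \<alpha> * N t)"
        by (simp only: U_red[OF w] N_def fixpoint(1) right_diff_distrib sum_subtractf sum_distrib_right)
          (simp add: algebra_simps flip: sum_distrib_right sum_distrib_left)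
      finally show ?thesis by (simp add: add_divide_distrib)
    qed
    have y_eq: "y t - Ly = \<beta> * (\<Sum>s<t. ?e s * (x s - Lx)) / (amount v0 + (\<Sum>s<t. ?e s)) + ?ey t" for t
    proof -
      have W: "amount v0 + (\<Sum>s<t. ?e s) \<noteq> 0"
        using amount_pos(2)[OF w, of t] amount_V[OF w, of t] by linarith
      have Ly_eq: "Ly * (\<Sum>s<t. ?e s) = (1 - \<beta>) * (\<Sum>s<t. ?e s) + \<beta> * (Lx * (\<Sum>s<t. ?e s))"
        by (subst fixpoint(2)) (simp add: algebra_simps)
      have "y t = V t w $ red / (amount v0 + (\<Sum>s<t. ?e s))"
        by (simp add: y_def proportion_def amount_V[OF w])
      then have "y t - Ly = (V t w $ red - Ly * (amount v0 + (\<Sum>s<t. ?e s))) / (amount v0 + (\<Sum>s<t. ?e s))"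
        using W by (simp add: diff_divide_distrib)
      \<comment> \<open>By the second fixed point equation an even time contributes
        \<open>\<beta> * (?I s - Lx)\<close>, which splits into drift and noise in the same
        way.\<close>
      also have "V t w $ red - Ly * (amount v0 + (\<Sum>s<t. ?e s))
          = \<beta> * (\<Sum>s<t. ?e s * (x s - Lx)) + ((v0 $ red - amount v0 * Ly) + \<beta> * K t)"
        unfolding distrib_left Ly_eq
        by (simp only: V_red[OF w] K_def right_diff_distrib sum_subtractf sum_distrib_right)
          (simp add: algebra_simps flip: sum_distrib_right sum_distrib_left)
      finally show ?thesis by (simp add: add_divide_distrib)
    qed
    have ex: "?ex \<longlonglongrightarrow> 0"
      using elim(2) by (intro noise_tendsto_0 half_weights_ge nonempty) (simp only: N_eq)
    have ey: "?ey \<longlonglongrightarrow> 0"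
      using elim(3) by (intro noise_tendsto_0 half_weights_ge nonempty) (simp only: K_eq)
    have "(\<lambda>t. x t - Lx) \<longlonglongrightarrow> 0" "(\<lambda>t. y t - Ly) \<longlonglongrightarrow> 0"
      using \<alpha> \<beta> nonempty
      by (intro coupled_means_tendsto_0[OF _ _ _ _ _ _ _ _ _ _ x_eq ex y_eq ey bnd]
          filterlim_half_weights half_weights_ge; simp)+
    then show ?case
      by (simp add: x_def y_def Lx_def Ly_def LIM_zero_iff)
  qed
qed

theorem AE_proportions:
  "AE w in M. (\<lambda>t. proportion (U t w)) \<longlonglongrightarrow>
     vector [(\<alpha> - \<alpha> * \<beta>) / (1 - \<alpha> * \<beta>), (1 - \<alpha>) / (1 - \<alpha> * \<beta>)]"
  "AE w in M. (\<lambda>t. proportion (V t w)) \<longlonglongrightarrow>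
     vector [(1 - \<beta>) / (1 - \<alpha> * \<beta>), (\<beta> - \<alpha> * \<beta>) / (1 - \<alpha> * \<beta>)]"
proof -
  have pos: "0 < 1 - \<alpha> * \<beta>"
    using \<alpha> \<beta> mult_strict_mono[of \<alpha> 1 \<beta> 1] by simp
  have black: "(1 - \<alpha>) / (1 - \<alpha> * \<beta>) = 1 - (\<alpha> - \<alpha> * \<beta>) / (1 - \<alpha> * \<beta>)"
    "(\<beta> - \<alpha> * \<beta>) / (1 - \<alpha> * \<beta>) = 1 - (1 - \<beta>) / (1 - \<alpha> * \<beta>)"
    using pos by (simp_all add: field_simps)
  show "AE w in M. (\<lambda>t. proportion (U t w)) \<longlonglongrightarrow>
     vector [(\<alpha> - \<alpha> * \<beta>) / (1 - \<alpha> * \<beta>), (1 - \<alpha>) / (1 - \<alpha> * \<beta>)]"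
    using AE_red_proportions AE_space
    by eventually_elim (auto simp: proportion_black amount_pos black intro!: tendsto_vec2 tendsto_diff)
  show "AE w in M. (\<lambda>t. proportion (V t w)) \<longlonglongrightarrow>
     vector [(1 - \<beta>) / (1 - \<alpha> * \<beta>), (\<beta> - \<alpha> * \<beta>) / (1 - \<alpha> * \<beta>)]"
    using AE_red_proportions AE_space
    by eventually_elim (auto simp: proportion_black amount_pos black intro!: tendsto_vec2 tendsto_diff)
qed

end

section \<open>Flipping in the limiting case\<close>

lemma (in prob_space) flips_iff:
  assumes "AE w in M. (\<lambda>t. X t w) \<longlonglongrightarrow> L"
  shows "flips M X c \<longleftrightarrow> (\<forall>j. j \<noteq> c \<longrightarrow> L $ c < L $ j)"
proof -
  \<comment> \<open>Almost sure limits are unique: both convergences hold together on a set of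
    probability 1, and an equation between constants that holds almost surely is true. So the limit
    quantified in \<open>flips\<close> must be \<open>L\<close>.\<close>
  have "L' = L" if "AE w in M. (\<lambda>t. X t w) \<longlonglongrightarrow> L'" for L'
  proof -
    have "AE w in M. L' = L"
      using that assms by eventually_elim (rule LIMSEQ_unique)
    then show ?thesis by simp
  qed
  then show ?thesis unfolding flips_def using assms by blast
qed

theorem corollary1:
  fixes \<alpha> \<beta> :: real
    and M :: "'a measure" and F :: "nat \<Rightarrow> 'a measure"
    and R1 R2 :: "real^2^2" and u0 v0 :: "real^2"
    and D :: "nat \<Rightarrow> 'a \<Rightarrow> 2"
    and U V X Y :: "nat \<Rightarrow> 'a \<Rightarrow> real^2"
  assumes "0 < \<alpha>" "\<alpha> < 1" "0 < \<beta>" "\<beta> < 1"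
    and R1: "R1 = vector [vector [\<alpha>, 1 - \<alpha>], vector [0, 1]]"
    and R2: "R2 = vector [vector [1, 0], vector [1 - \<beta>, \<beta>]]"
    and urns: "cyclic_urns M F R1 R2 u0 v0 D U V"
    and nonempty: "0 < amount u0" "0 < amount v0"
    and X: "X = (\<lambda>t w. proportion (U t w))"
    and Y: "Y = (\<lambda>t w. proportion (V t w))"
  shows "((AE w in M. (\<lambda>t. X t w) \<longlonglongrightarrow>
            vector [(\<alpha> - \<alpha> * \<beta>) / (1 - \<alpha> * \<beta>), (1 - \<alpha>) / (1 - \<alpha> * \<beta>)]) \<and>
          (AE w in M. (\<lambda>t. Y t w) \<longlonglongrightarrow>
            vector [(1 - \<beta>) / (1 - \<alpha> * \<beta>), (\<beta> - \<alpha> * \<beta>) / (1 - \<alpha> * \<beta>)])) \<and>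
         ((\<not> flips M X black \<and> \<not> flips M Y red) \<or>
          (flips M X black \<and> \<not> flips M Y red) \<or>
          (\<not> flips M X black \<and> flips M Y red)) \<and>
         \<not> (flips M X black \<and> flips M Y red)"
proof -
  interpret cyclic_urns M F R1 R2 u0 v0 D U V by (rule urns)
  interpret flipping_urns M F R1 R2 u0 v0 D U V \<alpha> \<beta>
    using assms by unfold_locales
  note lims = AE_proportions[folded fun_cong[OF fun_cong[OF X]] fun_cong[OF fun_cong[OF Y]]]
  have pos: "0 < 1 - \<alpha> * \<beta>"
    using \<alpha> \<beta> mult_strict_mono[of \<alpha> 1 \<beta> 1] by simp
  have "\<not> (flips M X black \<and> flips M Y red)"
  proof
    assume "flips M X black \<and> flips M Y red"
    \<comment> \<open>All limit coordinates share the positive denominator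
      \<open>1 - \<alpha> * \<beta>\<close>, so only the numerators are compared.\<close>
    then have "1 - \<alpha> < \<alpha> - \<alpha> * \<beta>" "1 - \<beta> < \<beta> - \<alpha> * \<beta>"
      using pos unfolding flips_iff[OF lims(1)] flips_iff[OF lims(2)]
      by (auto simp: forall_2 divide_less_cancel)
    moreover have "0 < (1 - \<alpha>) * (1 - \<beta>)" using \<alpha> \<beta> by simp
    ultimately show False by (simp add: algebra_simps)
  qed
  \<comment> \<open>The three admissible cases are together the negation of both urns
    flipping.\<close>
  then show ?thesis using lims by blast
qed

end
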